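(* Let $G$ be a finitely generated group with the patching property. Then every strongly contractible $G$-subshift is a contractible subshift of finite type. If moreover $G = \mathbb{Z}^d$ for some $d \geq 1$, or the subshift in question has a fixed point, the converse holds: every contractible $\mathbb{Z}^d$-subshift of finite type is strongly contractible, and every contractible $G$-subshift of finite type containing a point fixed by all of $G$ is strongly contractible.
   Context: For a finite set $A$ (alphabet) and a group $G$, $A^G$ carries the product topology (discrete $A$) and the shift action $(gx)_h = x_{g^{-1}h}$. A subshift is a topologically closed, shift-invariant subset $X \subset A^G$. A finite pattern is an element $p \in A^D$ with $D \subset G$ finite; it appears in $x \in A^G$ if for some $g \in G$ one has $x_{gd} = p_d$ for all $d \in D$. $X$ is of finite type (SFT) if there is a finite set of finite patterns such that $X$ is the set of all $x \in A^G$ in which none of them appears. A block map between $G$-subshifts is a continuous shift-commuting map; products carry the diagonal action. Let $I = \{0,1\}^G$, and let $\bar 0, \bar 1 \in I$ be the constant configurations. A subshift $X$ is contractible if there is a block map $h : I \times X \times X \to X$ with $h(\bar 0, x, y) = x$ and $h(\bar 1, x, y) = y$ for all $x, y \in X$. It is strongly contractible if such an $h$ can be chosen with additionally $h(t, x, x) = x$ for all $t \in I$, $x \in X$. Patching property: fix a finite symmetric generating set of $G$, and let $B_r$ be the ball of radius $r$ around $1_G$ for the left-invariant word metric. For $A \subset G$ write $A^{\circ r} = \{a \in G : aB_r \subset A\}$. The $r$-almost-union of $A, B \subset G$ is $$A \overset{r}{\cup} B = A^{\circ r} \cup B^{\circ r} \cup \big((A \cup B) \setminus (AB_r \cap BB_r)\big).$$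 For $r, R \in \mathbb{N}$ let $\mathcal{C}_{r,R}$ be the smallest family of subsets of $G$ which contains all left translates $aB_R$, $a \in G$, and is closed under the $r$-almost-union operation and under taking subsets. $G$ has the patching property if for all $r$ there exists $R$ such that $\mathcal{C}_{r,R}$ contains all balls of radius larger than $R$. (This does not depend on the choice of generating set.) *)

theory Defs
  imports "HOL-Analysis.Analysis" "HOL-Algebra.Product_Groups"
begin

subsection \<open>Subshifts over a finite alphabet\<close>

text \<open>Configurations are functions that are extensional on the carrier of the group, so that
  \<open>A\<^sup>G\<close> is the topological space below, whose underlying set is \<open>carrier G \<rightarrow>\<^sub>E A\<close>.\<close>

definition full_shift :: "('g, 'm) monoid_scheme \<Rightarrow> 'a set \<Rightarrow> ('g \<Rightarrow> 'a) topology" where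
  "full_shift G A = product_topology (\<lambda>_. discrete_topology A) (carrier G)"

definition shift :: "('g, 'm) monoid_scheme \<Rightarrow> 'g \<Rightarrow> ('g \<Rightarrow> 'a) \<Rightarrow> 'g \<Rightarrow> 'a" where
  "shift G g x = (\<lambda>h\<in>carrier G. x (inv\<^bsub>G\<^esub> g \<otimes>\<^bsub>G\<^esub> h))"

definition subshift :: "('g, 'm) monoid_scheme \<Rightarrow> 'a set \<Rightarrow> ('g \<Rightarrow> 'a) set \<Rightarrow> bool" where
  "subshift G A X \<longleftrightarrow> finite A \<and> closedin (full_shift G A) X \<and>
     (\<forall>g\<in>carrier G. \<forall>x\<in>X. shift G g x \<in> X)"

text \<open>A pattern \<open>p \<in> A\<^sup>D\<close> is given as the pair \<open>(D, p)\<close>.\<close>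

definition finite_pattern :: "('g, 'm) monoid_scheme \<Rightarrow> 'a set \<Rightarrow> 'g set \<times> ('g \<Rightarrow> 'a) \<Rightarrow> bool" where
  "finite_pattern G A = (\<lambda>(D, p). finite D \<and> D \<subseteq> carrier G \<and> p \<in> D \<rightarrow>\<^sub>E A)"

definition appears_in ::
    "('g, 'm) monoid_scheme \<Rightarrow> 'g set \<times> ('g \<Rightarrow> 'a) \<Rightarrow> ('g \<Rightarrow> 'a) \<Rightarrow> bool" where
  "appears_in G = (\<lambda>(D, p) x. \<exists>g\<in>carrier G. \<forall>d\<in>D. x (g \<otimes>\<^bsub>G\<^esub> d) = p d)"

definition finite_type :: "('g, 'm) monoid_scheme \<Rightarrow> 'a set \<Rightarrow> ('g \<Rightarrow> 'a) set \<Rightarrow> bool" where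
  "finite_type G A X \<longleftrightarrow>
     (\<exists>F. finite F \<and> (\<forall>P\<in>F. finite_pattern G A P) \<and>
          X = {x \<in> carrier G \<rightarrow>\<^sub>E A. \<forall>P\<in>F. \<not> appears_in G P x})"

definition fixed_point :: "('g, 'm) monoid_scheme \<Rightarrow> ('g \<Rightarrow> 'a) \<Rightarrow> bool" where
  "fixed_point G x \<longleftrightarrow> (\<forall>g\<in>carrier G. shift G g x = x)"

subsection \<open>Block maps and contractibility\<close>

text \<open>A block map from the space \<open>S\<close> with action \<open>\<alpha>\<close> to the space \<open>T\<close> with action \<open>\<beta>\<close>; keeping the
  actions explicit allows products of subshifts, with the diagonal action, as domains.\<close>

definition block_map ::
    "('g, 'm) monoid_scheme \<Rightarrow> 'u topology \<Rightarrow> ('g \<Rightarrow> 'u \<Rightarrow> 'u) \<Rightarrow>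
     'v topology \<Rightarrow> ('g \<Rightarrow> 'v \<Rightarrow> 'v) \<Rightarrow> ('u \<Rightarrow> 'v) \<Rightarrow> bool" where
  "block_map G S \<alpha> T \<beta> f \<longleftrightarrow> continuous_map S T f \<and>
     (\<forall>g\<in>carrier G. \<forall>u\<in>topspace S. f (\<alpha> g u) = \<beta> g (f u))"

definition binary_shift :: "('g, 'm) monoid_scheme \<Rightarrow> ('g \<Rightarrow> nat) topology" where
  "binary_shift G = full_shift G {0, 1}"

definition const_config :: "('g, 'm) monoid_scheme \<Rightarrow> 'a \<Rightarrow> 'g \<Rightarrow> 'a" where
  "const_config G a = (\<lambda>h\<in>carrier G. a)"

definition contraction ::
    "('g, 'm) monoid_scheme \<Rightarrow> 'a set \<Rightarrow> ('g \<Rightarrow> 'a) set \<Rightarrow>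
     (('g \<Rightarrow> nat) \<times> ('g \<Rightarrow> 'a) \<times> ('g \<Rightarrow> 'a) \<Rightarrow> 'g \<Rightarrow> 'a) \<Rightarrow> bool" where
  "contraction G A X h \<longleftrightarrow>
     (let TX = subtopology (full_shift G A) X in
      block_map G
        (prod_topology (binary_shift G) (prod_topology TX TX))
        (\<lambda>g. map_prod (shift G g) (map_prod (shift G g) (shift G g)))
        TX (shift G) h) \<and>
     (\<forall>x\<in>X. \<forall>y\<in>X. h (const_config G 0, x, y) = x \<and> h (const_config G 1, x, y) = y)"

definition contractible_subshift ::
    "('g, 'm) monoid_scheme \<Rightarrow> 'a set \<Rightarrow> ('g \<Rightarrow> 'a) set \<Rightarrow> bool" where
  "contractible_subshift G A X \<longleftrightarrow> (\<exists>h. contraction G A X h)"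

definition strongly_contractible_subshift ::
    "('g, 'm) monoid_scheme \<Rightarrow> 'a set \<Rightarrow> ('g \<Rightarrow> 'a) set \<Rightarrow> bool" where
  "strongly_contractible_subshift G A X \<longleftrightarrow>
     (\<exists>h. contraction G A X h \<and>
          (\<forall>t\<in>topspace (binary_shift G). \<forall>x\<in>X. h (t, x, x) = x))"

subsection \<open>Word metric and the patching property\<close>

definition symmetric_generating_set :: "('g, 'm) monoid_scheme \<Rightarrow> 'g set \<Rightarrow> bool" where
  "symmetric_generating_set G S \<longleftrightarrow>
     S \<subseteq> carrier G \<and> (\<forall>s\<in>S. inv\<^bsub>G\<^esub> s \<in> S) \<and> generate G S = carrier G"

definition word_length :: "('g, 'm) monoid_scheme \<Rightarrow> 'g set \<Rightarrow> 'g \<Rightarrow> nat" where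
  "word_length G S g =
     (LEAST n. \<exists>w. set w \<subseteq> S \<and> length w = n \<and> foldr (\<otimes>\<^bsub>G\<^esub>) w \<one>\<^bsub>G\<^esub> = g)"

definition word_dist :: "('g, 'm) monoid_scheme \<Rightarrow> 'g set \<Rightarrow> 'g \<Rightarrow> 'g \<Rightarrow> nat" where
  "word_dist G S g h = word_length G S (inv\<^bsub>G\<^esub> g \<otimes>\<^bsub>G\<^esub> h)"

definition word_ball :: "('g, 'm) monoid_scheme \<Rightarrow> 'g set \<Rightarrow> nat \<Rightarrow> 'g set" where
  "word_ball G S r = {g \<in> carrier G. word_dist G S \<one>\<^bsub>G\<^esub> g \<le> r}"

definition erosion :: "('g, 'm) monoid_scheme \<Rightarrow> 'g set \<Rightarrow> nat \<Rightarrow> 'g set \<Rightarrow> 'g set" where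
  "erosion G S r U = {a \<in> carrier G. a <#\<^bsub>G\<^esub> word_ball G S r \<subseteq> U}"

definition almost_union ::
    "('g, 'm) monoid_scheme \<Rightarrow> 'g set \<Rightarrow> nat \<Rightarrow> 'g set \<Rightarrow> 'g set \<Rightarrow> 'g set" where
  "almost_union G S r U V =
     erosion G S r U \<union> erosion G S r V \<union>
     ((U \<union> V) - ((U <#>\<^bsub>G\<^esub> word_ball G S r) \<inter> (V <#>\<^bsub>G\<^esub> word_ball G S r)))"

inductive_set patching_family ::
    "('g, 'm) monoid_scheme \<Rightarrow> 'g set \<Rightarrow> nat \<Rightarrow> nat \<Rightarrow> 'g set set"
  for G :: "('g, 'm) monoid_scheme" and S r R where
  ball: "a \<in> carrier G \<Longrightarrow> a <#\<^bsub>G\<^esub> word_ball G S R \<in> patching_family G S r R"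
| almost_union: "U \<in> patching_family G S r R \<Longrightarrow> V \<in> patching_family G S r R \<Longrightarrow>
     almost_union G S r U V \<in> patching_family G S r R"
| subset: "U \<in> patching_family G S r R \<Longrightarrow> V \<subseteq> U \<Longrightarrow> V \<in> patching_family G S r R"

definition patching_property :: "('g, 'm) monoid_scheme \<Rightarrow> 'g set \<Rightarrow> bool" where
  "patching_property G S \<longleftrightarrow>
     (\<forall>r. \<exists>R. \<forall>n>R. \<forall>a\<in>carrier G. a <#\<^bsub>G\<^esub> word_ball G S n \<in> patching_family G S r R)"

subsection \<open>The groups \<open>\<int>\<^sup>d\<close>\<close>

definition int_lattice :: "nat \<Rightarrow> (nat \<Rightarrow> int) monoid" where
  "int_lattice d = product_group {..<d} (\<lambda>_. integer_group)"

end

theory Submission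
  imports Defs
begin

text \<open>
  By compactness a contraction \<open>h\<close> is a local rule of some radius \<open>r\<close>.

  If \<open>h\<close> is strong, let \<open>u\<close> and \<open>v\<close> in \<open>X\<close> coincide with a given configuration \<open>x\<close> on \<open>U\<close> and \<open>V\<close>
  respectively. For \<open>t\<close> equal to \<open>0\<close> around \<open>U - V\<close> and to \<open>1\<close> around \<open>V - U\<close>, the point
  \<open>h (t, u, v)\<close> coincides with \<open>x\<close> on the \<open>3 * r\<close>-almost-union of \<open>U\<close> and \<open>V\<close>: in the middle of
  \<open>U \<inter> V\<close> the value of \<open>t\<close> is irrelevant, since there \<open>h\<close> cannot tell \<open>v\<close> from \<open>u\<close>. Patching
  therefore extends local admissibility to all large balls, and \<open>X\<close> is of finite type.

  Conversely, let \<open>X\<close> be of finite type and \<open>h\<close> arbitrary. Replacing \<open>h (t, x, y)\<close> by \<open>x\<close> far away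
  from all disagreements of \<open>x\<close> and \<open>y\<close> gives a configuration that can be invalid only at crossings,
  where the boundary of this far region meets the boundary of \<open>t\<close>. It is repaired by applying \<open>h\<close>
  once more, to contract it to \<open>x\<close> around the crossings. If \<open>t\<close> is constant or \<open>x = y\<close>, there are
  no crossings and nothing is changed.
\<close>

section \<open>Word balls and neighbourhoods in a finitely generated group\<close>

locale marked_group = group G for G :: "('g, 'm) monoid_scheme" (structure) +
  fixes S :: "'g set"
  assumes finite_gens: "finite S" and sym_gens: "symmetric_generating_set G S"
begin

abbreviation ball :: "nat \<Rightarrow> 'g set" where "ball \<equiv> word_ball G S"

text \<open>By left invariance, the translate of the ball by \<open>g\<close> is the ball of the
  same radius around \<open>g\<close>. Hence \<open>nbhd_refl\<close>, \<open>nbhd_sym\<close> and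
  \<open>nbhd_trans\<close> play the part of the metric axioms.\<close>

abbreviation nbhd :: "'g \<Rightarrow> nat \<Rightarrow> 'g set" where "nbhd g r \<equiv> l_coset G g (ball r)"

abbreviation word_prod :: "'g list \<Rightarrow> 'g" where "word_prod w \<equiv> foldr (\<otimes>) w \<one>"

lemma gens_closed: "S \<subseteq> carrier G" and gens_inv: "s \<in> S \<Longrightarrow> inv s \<in> S"
  and generate_gens: "generate G S = carrier G"
  using sym_gens by (auto simp: symmetric_generating_set_def)

lemma word_prod_closed: "set w \<subseteq> S \<Longrightarrow> word_prod w \<in> carrier G"
  using gens_closed by (induction w) auto

lemma word_prod_append:
  "set v \<subseteq> S \<Longrightarrow> set w \<subseteq> S \<Longrightarrow> word_prod (v @ w) = word_prod v \<otimes> word_prod w"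
proof (induction v)
  case Nil
  then show ?case by (simp add: word_prod_closed)
next
  case (Cons a v)
  then have "a \<in> carrier G" "word_prod v \<in> carrier G" "word_prod w \<in> carrier G"
    using gens_closed word_prod_closed by auto
  with Cons show ?case by (simp add: m_assoc)
qed

lemma word_prod_inv:
  "set w \<subseteq> S \<Longrightarrow> word_prod (rev (map (\<lambda>s. inv s) w)) = inv (word_prod w)"
proof (induction w)
  case (Cons a w)
  then have a: "a \<in> carrier G" "inv a \<in> S" and w: "word_prod w \<in> carrier G"
    using gens_closed gens_inv word_prod_closed by auto
  have "word_prod (rev (map (\<lambda>s. inv s) (a # w))) =
      word_prod (rev (map (\<lambda>s. inv s) w) @ [inv a])" by simp
  also have "\<dots> = word_prod (rev (map (\<lambda>s. inv s) w)) \<otimes> word_prod [inv a]"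
    by (rule word_prod_append) (use Cons.prems a gens_inv in auto)
  finally show ?case using Cons a w by (simp add: inv_mult_group)
qed simp

lemma word_exists:
  assumes "g \<in> carrier G" obtains w where "set w \<subseteq> S" "word_prod w = g"
proof -
  have "g \<in> generate G S" using assms generate_gens by simp
  then have "\<exists>w. set w \<subseteq> S \<and> word_prod w = g"
  proof (induction rule: generate.induct)
    case one
    show ?case by (rule exI[of _ "[]"]) simp
  next
    case (incl h)
    then show ?case using gens_closed by (intro exI[of _ "[h]"]) auto
  next
    case (inv h)
    then show ?case using gens_closed gens_inv by (intro exI[of _ "[inv h]"]) auto
  next
    case (eng h1 h2)
    then obtain v w where "set v \<subseteq> S" "word_prod v = h1" "set w \<subseteq> S" "word_prod w = h2" by auto
    then show ?case by (intro exI[of _ "v @ w"]) (simp add: word_prod_append del: foldr_append)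
  qed
  then show ?thesis using that by blast
qed

text \<open>Because \<open>S\<close> generates, the \<open>LEAST\<close> in
  \<open>word_length\<close> is attained. Products, inverses and finiteness of balls can then be
  read off from words.\<close>

lemma ball_eq: "ball r = word_prod ` {w. set w \<subseteq> S \<and> length w \<le> r}"
proof -
  have "word_length G S g \<le> r \<longleftrightarrow> (\<exists>w. set w \<subseteq> S \<and> length w \<le> r \<and> word_prod w = g)"
    if g: "g \<in> carrier G" for g
  proof -
    obtain w where w: "set w \<subseteq> S" "word_prod w = g" by (rule word_exists[OF g])
    have "\<exists>w. set w \<subseteq> S \<and> length w = word_length G S g \<and> word_prod w = g"
      unfolding word_length_def by (rule LeastI[of _ "length w"]) (use w in blast)
    moreover have "word_length G S g \<le> length w" if "set w \<subseteq> S" "word_prod w = g" for w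
      unfolding word_length_def by (rule Least_le) (use that in blast)
    ultimately show ?thesis using order_trans by (metis (no_types, lifting))
  qed
  moreover have "g \<in> ball r \<longleftrightarrow> g \<in> carrier G \<and> word_length G S g \<le> r" for g
    by (auto simp: word_ball_def word_dist_def)
  ultimately show ?thesis using word_prod_closed by blast
qed

lemma ball_closed: "b \<in> ball r \<Longrightarrow> b \<in> carrier G"
  by (simp add: word_ball_def)

lemma ball_one: "\<one> \<in> ball r"
  unfolding ball_eq by (rule image_eqI[of _ _ "[]"]) auto

lemma ball_mult: "a \<in> ball m \<Longrightarrow> b \<in> ball n \<Longrightarrow> a \<otimes> b \<in> ball (m + n)"
proof -
  assume "a \<in> ball m" "b \<in> ball n"
  then obtain v w where "set v \<subseteq> S" "length v \<le> m" "a = word_prod v"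
    "set w \<subseteq> S" "length w \<le> n" "b = word_prod w" unfolding ball_eq by auto
  then show ?thesis unfolding ball_eq
    by (intro image_eqI[of _ _ "v @ w"]) (simp_all add: word_prod_append del: foldr_append)
qed

lemma ball_inv: "b \<in> ball r \<Longrightarrow> inv b \<in> ball r"
proof -
  assume "b \<in> ball r"
  then obtain w where "set w \<subseteq> S" "length w \<le> r" "b = word_prod w" unfolding ball_eq by auto
  then show ?thesis unfolding ball_eq
    by (intro image_eqI[of _ _ "rev (map (\<lambda>s. inv s) w)"])
      (use gens_inv in \<open>auto simp del: rev_map simp: word_prod_inv\<close>)
qed

lemma ball_mono: "m \<le> n \<Longrightarrow> ball m \<subseteq> ball n"
  unfolding ball_eq by auto

lemma finite_ball: "finite (ball r)"
  unfolding ball_eq by (intro finite_imageI finite_lists_length_le finite_gens)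

lemma finite_subset_ball:
  assumes "finite M" "M \<subseteq> carrier G" shows "\<exists>n. M \<subseteq> ball n"
  using assms
proof (induction rule: finite_induct)
  case (insert g M)
  then obtain n where n: "M \<subseteq> ball n" by auto
  obtain w where "set w \<subseteq> S" "word_prod w = g" using insert.prems word_exists by auto
  then have "g \<in> ball (length w)" unfolding ball_eq by auto
  then show ?case
    using n ball_mono[of n "max n (length w)"] ball_mono[of "length w" "max n (length w)"]
    by (intro exI[of _ "max n (length w)"]) auto
qed simp

lemma nbhd_iff: "h \<in> nbhd g r \<longleftrightarrow> (\<exists>b\<in>ball r. h = g \<otimes> b)"
  by (auto simp: l_coset_def)

lemma nbhd_Ball: "(\<forall>k\<in>nbhd g r. P k) \<longleftrightarrow> (\<forall>b\<in>ball r. P (g \<otimes> b))"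
  by (simp add: l_coset_def)

lemma nbhd_closed: "g \<in> carrier G \<Longrightarrow> h \<in> nbhd g r \<Longrightarrow> h \<in> carrier G"
  by (auto simp: nbhd_iff ball_closed)

lemma nbhd_refl: "g \<in> carrier G \<Longrightarrow> g \<in> nbhd g r"
  using ball_one by (force simp: nbhd_iff)

lemma nbhd_one: "nbhd \<one> r = ball r"
  using ball_closed by (auto simp: nbhd_iff)

lemma nbhd_sym: "g \<in> carrier G \<Longrightarrow> h \<in> nbhd g r \<Longrightarrow> g \<in> nbhd h r"
proof -
  assume g: "g \<in> carrier G" and "h \<in> nbhd g r"
  then obtain b where b: "b \<in> ball r" "h = g \<otimes> b" by (auto simp: nbhd_iff)
  with g have "g = h \<otimes> inv b" by (simp add: ball_closed m_assoc)
  then show ?thesis using b ball_inv by (auto simp: nbhd_iff)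
qed

lemma nbhd_trans:
  assumes "g \<in> carrier G" "h \<in> nbhd g m" "k \<in> nbhd h n" "m + n \<le> l"
  shows "k \<in> nbhd g l"
proof -
  obtain a b where "a \<in> ball m" "b \<in> ball n" "h = g \<otimes> a" "k = h \<otimes> b"
    using assms by (auto simp: nbhd_iff)
  then have "k = g \<otimes> (a \<otimes> b)" "a \<otimes> b \<in> ball l"
    using assms ball_closed ball_mult[of a m b n] ball_mono[of "m + n" l] by (auto simp: m_assoc)
  then show ?thesis by (auto simp: nbhd_iff)
qed

lemma nbhd_mono: "m \<le> n \<Longrightarrow> nbhd g m \<subseteq> nbhd g n"
  using ball_mono by (fastforce simp: nbhd_iff)

lemma finite_nbhd: "finite (nbhd g r)"
  by (simp add: l_coset_def finite_ball)

subsection \<open>Cylinders and local rules\<close>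

abbreviation configs :: "'a set \<Rightarrow> ('g \<Rightarrow> 'a) set" where "configs A \<equiv> carrier G \<rightarrow>\<^sub>E A"

lemma topspace_full_shift [simp]: "topspace (full_shift G A) = configs A"
  by (simp add: full_shift_def)

lemma compact_full_shift: "finite A \<Longrightarrow> compact_space (full_shift G A)"
  unfolding full_shift_def
  by (simp add: compact_space_product_topology compact_space_discrete_topology)

text \<open>A cylinder is a box with one-point factors at the finitely many coordinates in
  \<open>M\<close> and the full factor \<open>A\<close> elsewhere.\<close>

lemma openin_cylinder:
  assumes "finite M" "M \<subseteq> carrier G" "x \<in> configs A"
  shows "openin (full_shift G A) {y \<in> configs A. \<forall>k\<in>M. y k = x k}"
proof -
  have "{y \<in> configs A. \<forall>k\<in>M. y k = x k} =
      (\<Pi>\<^sub>E k\<in>carrier G. if k \<in> M then {x k} else A)"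
    using assms by (auto simp: PiE_iff extensional_def split: if_splits)
  moreover have "finite {k \<in> carrier G. (if k \<in> M then {x k} else A) \<noteq> A}"
    by (rule finite_subset[OF _ assms(1)]) auto
  then have "openin (full_shift G A) (\<Pi>\<^sub>E k\<in>carrier G. if k \<in> M then {x k} else A)"
    unfolding full_shift_def using assms by (subst openin_PiE_gen) auto
  ultimately show ?thesis by simp
qed

text \<open>A basic box restricts finitely many coordinates, and these lie in some ball.\<close>

lemma open_contains_cylinder:
  assumes "openin (full_shift G A) U" "x \<in> U"
  shows "\<exists>n. \<forall>y\<in>configs A. (\<forall>k\<in>ball n. y k = x k) \<longrightarrow> y \<in> U"
proof -
  obtain W where W: "finite {i \<in> carrier G. W i \<noteq> A}"
    "x \<in> Pi\<^sub>E (carrier G) W" "Pi\<^sub>E (carrier G) W \<subseteq> U"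
    using assms unfolding full_shift_def openin_product_topology_alt topspace_discrete_topology
    by blast
  obtain n where n: "{i \<in> carrier G. W i \<noteq> A} \<subseteq> ball n"
    using finite_subset_ball[OF W(1)] by auto
  have "y \<in> U" if y: "y \<in> configs A" "\<forall>k\<in>ball n. y k = x k" for y
  proof -
    have "y k \<in> W k" if k: "k \<in> carrier G" for k
    proof (cases "W k = A")
      case False
      then have "k \<in> ball n" using n k by auto
      then show ?thesis using y W(2) k by auto
    qed (use y k in auto)
    then have "y \<in> Pi\<^sub>E (carrier G) W" using y by (auto simp: PiE_iff)
    then show ?thesis using W(3) by blast
  qed
  then show ?thesis by blast
qed

lemma shift_apply [simp]: "k \<in> carrier G \<Longrightarrow> shift G g x k = x (inv g \<otimes> k)"
  by (simp add: shift_def)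

text \<open>This moves a witness in \<open>X\<close> from one place to another: the shifted
  configuration shows at \<open>g\<close> what \<open>x\<close> shows at \<open>k\<close>.\<close>

lemma shift_translate:
  assumes "g \<in> carrier G" "k \<in> carrier G" "b \<in> carrier G"
  shows "shift G (g \<otimes> inv k) x (g \<otimes> b) = x (k \<otimes> b)"
proof -
  have "inv (g \<otimes> inv k) \<otimes> (g \<otimes> b) = k \<otimes> b"
    using assms by (simp add: inv_mult_group m_assoc inv_solve_left')
  then show ?thesis using assms by simp
qed

lemma shift_configs: "g \<in> carrier G \<Longrightarrow> x \<in> configs A \<Longrightarrow> shift G g x \<in> configs A"
  by (auto simp: shift_def)

text \<open>Comparing views at two different group elements makes one condition, dependence on the view
  only, express shift-equivariance and continuity at once.\<close>

definition same_view ::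
    "nat \<Rightarrow> ('g \<Rightarrow> nat) \<times> ('g \<Rightarrow> 'a) \<times> ('g \<Rightarrow> 'a) \<Rightarrow> 'g \<Rightarrow>
     ('g \<Rightarrow> nat) \<times> ('g \<Rightarrow> 'a) \<times> ('g \<Rightarrow> 'a) \<Rightarrow> 'g \<Rightarrow> bool" where
  "same_view n u g u' g' \<longleftrightarrow> (\<forall>b\<in>ball n.
     fst u (g \<otimes> b) = fst u' (g' \<otimes> b) \<and>
     fst (snd u) (g \<otimes> b) = fst (snd u') (g' \<otimes> b) \<and>
     snd (snd u) (g \<otimes> b) = snd (snd u') (g' \<otimes> b))"

abbreviation triples ::
    "('g \<Rightarrow> 'a) set \<Rightarrow> (('g \<Rightarrow> nat) \<times> ('g \<Rightarrow> 'a) \<times> ('g \<Rightarrow> 'a)) set" where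
  "triples X \<equiv> configs {0, 1} \<times> X \<times> X"

text \<open>The value type is arbitrary, so that Boolean conditions on a position are local rules
  too and can be combined by the closure lemmas below.\<close>

definition local_rule ::
    "('g \<Rightarrow> 'a) set \<Rightarrow> nat \<Rightarrow>
     (('g \<Rightarrow> nat) \<times> ('g \<Rightarrow> 'a) \<times> ('g \<Rightarrow> 'a) \<Rightarrow> 'g \<Rightarrow> 'b) \<Rightarrow> bool" where
  "local_rule X n F \<longleftrightarrow> (\<forall>u\<in>triples X. \<forall>u'\<in>triples X. \<forall>g\<in>carrier G. \<forall>g'\<in>carrier G.
     same_view n u g u' g' \<longrightarrow> F u g = F u' g')"

lemma same_view_mono: "same_view n u g u' g' \<Longrightarrow> m \<le> n \<Longrightarrow> same_view m u g u' g'"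
  using ball_mono unfolding same_view_def by blast

lemma same_view_move:
  assumes "same_view (m + n) u g u' g'" "b \<in> ball m" "g \<in> carrier G" "g' \<in> carrier G"
  shows "same_view n u (g \<otimes> b) u' (g' \<otimes> b)"
  using assms ball_mult[of b m _ n] unfolding same_view_def
  by (simp add: ball_closed m_assoc)

lemma local_rule_mono: "local_rule X m F \<Longrightarrow> m \<le> n \<Longrightarrow> local_rule X n F"
  using same_view_mono unfolding local_rule_def by blast

lemma local_ruleD:
  assumes "local_rule X n F" "same_view n u g u' g'" "u \<in> triples X" "u' \<in> triples X"
    "g \<in> carrier G" "g' \<in> carrier G"
  shows "F u g = F u' g'"
  using assms unfolding local_rule_def by blast

lemma local_rule_cong_nbhd:
  assumes "local_rule X n F" "(t, x, y) \<in> triples X" "(t', x', y') \<in> triples X" "g \<in> carrier G"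
    "\<And>k. k \<in> nbhd g n \<Longrightarrow> t k = t' k" "\<And>k. k \<in> nbhd g n \<Longrightarrow> x k = x' k"
    "\<And>k. k \<in> nbhd g n \<Longrightarrow> y k = y' k"
  shows "F (t, x, y) g = F (t', x', y') g"
proof (rule local_ruleD[OF assms(1)])
  show "same_view n (t, x, y) g (t', x', y') g"
    unfolding same_view_def using assms(5-7) by (auto simp: nbhd_iff)
qed (use assms in auto)

text \<open>Both neighbourhoods are indexed by the same \<open>ball m\<close>, so the values can be
  compared offset by offset; a view of radius \<open>m + n\<close> contains the view of radius
  \<open>n\<close> at each offset.\<close>

lemma local_rule_Ball:
  assumes "local_rule X n F"
  shows "local_rule X (m + n) (\<lambda>u g. \<forall>k\<in>nbhd g m. F u k)"
proof -
  have *: "F u (g \<otimes> b) = F u' (g' \<otimes> b)"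
    if "u \<in> triples X" "u' \<in> triples X" "g \<in> carrier G" "g' \<in> carrier G"
      "same_view (m + n) u g u' g'" "b \<in> ball m" for u u' g g' b
    using that ball_closed by (intro local_ruleD[OF assms]) (auto intro: same_view_move)
  show ?thesis unfolding local_rule_def nbhd_Ball by (intro ballI impI ball_cong refl *)
qed


lemma local_rule_map: "local_rule X n F \<Longrightarrow> local_rule X n (\<lambda>u g. f (F u g))"
  unfolding local_rule_def by (intro ballI impI arg_cong[where f = f]) blast

lemma local_rule_map2:
  "local_rule X n F \<Longrightarrow> local_rule X n F' \<Longrightarrow> local_rule X n (\<lambda>u g. f (F u g) (F' u g))"
  unfolding local_rule_def by (intro ballI impI arg_cong2[where f = f]) blast+

lemma local_rule_Bex:
  assumes "local_rule X n F"
  shows "local_rule X (m + n) (\<lambda>u g. \<exists>k\<in>nbhd g m. F u k)"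
  using local_rule_map[OF local_rule_Ball[OF local_rule_map[OF assms, of Not], of m], of Not] by simp

lemma local_rule_proj:
  shows "local_rule X n fst" "local_rule X n (\<lambda>u. fst (snd u))" "local_rule X n (\<lambda>u. snd (snd u))"
proof -
  have "fst u g = fst u' g' \<and> fst (snd u) g = fst (snd u') g' \<and> snd (snd u) g = snd (snd u') g'"
    if "same_view n u g u' g'" "g \<in> carrier G" "g' \<in> carrier G" for u u' g g'
    using that bspec[OF that(1)[unfolded same_view_def] ball_one] by simp
  then show "local_rule X n fst" "local_rule X n (\<lambda>u. fst (snd u))"
    "local_rule X n (\<lambda>u. snd (snd u))"
    unfolding local_rule_def by blast+
qed

subsection \<open>Block maps are local rules\<close>

abbreviation act where "act g \<equiv> map_prod (shift G g) (map_prod (shift G g) (shift G g))"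

abbreviation triple_space where
  "triple_space A X \<equiv> prod_topology (binary_shift G)
     (prod_topology (subtopology (full_shift G A) X) (subtopology (full_shift G A) X))"

lemma subshift_subset: "subshift G A X \<Longrightarrow> X \<subseteq> configs A"
  using closedin_subset[of "full_shift G A" X] by (auto simp: subshift_def)

lemma subshift_shift: "subshift G A X \<Longrightarrow> g \<in> carrier G \<Longrightarrow> x \<in> X \<Longrightarrow> shift G g x \<in> X"
  by (auto simp: subshift_def)

lemma topspace_triple_space: "subshift G A X \<Longrightarrow> topspace (triple_space A X) = triples X"
  using subshift_subset by (auto simp: binary_shift_def)

lemma act_triples:
  "subshift G A X \<Longrightarrow> g \<in> carrier G \<Longrightarrow> u \<in> triples X \<Longrightarrow> act g u \<in> triples X"
  by (cases u) (simp add: shift_configs subshift_shift)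

lemma same_view_act:
  assumes "g \<in> carrier G" "k \<in> carrier G"
  shows "same_view n (act g u) k u (inv g \<otimes> k)"
  using assms by (auto simp: same_view_def ball_closed m_assoc)

lemma openin_triple_cylinder:
  assumes sub: "subshift G A X" and u: "u \<in> triples X" and g: "g \<in> carrier G"
  shows "openin (triple_space A X) {v \<in> triples X. same_view n u g v g}"
proof -
  obtain t x y where [simp]: "u = (t, x, y)" by (cases u)
  let ?C = "\<lambda>A x. {y \<in> carrier G \<rightarrow>\<^sub>E A. \<forall>k\<in>nbhd g n. y k = x k}"
  have M: "finite (nbhd g n)" "nbhd g n \<subseteq> carrier G"
    using finite_nbhd nbhd_closed[OF g] by auto
  have X: "X \<subseteq> configs A" by (rule subshift_subset[OF sub])
  have "openin (full_shift G {0, 1}) (?C {0, 1} t)" "openin (full_shift G A) (?C A x)"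
    "openin (full_shift G A) (?C A y)"
    using u X by (auto intro!: openin_cylinder[OF M])
  then have "openin (triple_space A X) (?C {0, 1} t \<times> (?C A x \<inter> X) \<times> (?C A y \<inter> X))"
    by (auto simp: openin_prod_Times_iff openin_subtopology_Int binary_shift_def)
  moreover have "?C {0, 1} t \<times> (?C A x \<inter> X) \<times> (?C A y \<inter> X) =
      {v \<in> triples X. same_view n u g v g}"
    using X by (auto simp: same_view_def nbhd_Ball)
  ultimately show ?thesis by simp
qed

lemma open_contains_triple_cylinder:
  assumes sub: "subshift G A X" and W: "openin (triple_space A X) W" "u \<in> W"
  shows "\<exists>n. \<forall>v\<in>triples X. same_view n u \<one> v \<one> \<longrightarrow> v \<in> W"
proof -
  obtain t x y where [simp]: "u = (t, x, y)" by (cases u)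
  obtain U V where U: "openin (binary_shift G) U" "t \<in> U" and V: "(x, y) \<in> V" "U \<times> V \<subseteq> W"
    "openin (prod_topology (subtopology (full_shift G A) X) (subtopology (full_shift G A) X)) V"
    using W unfolding openin_prod_topology_alt[of "binary_shift G"] by force
  obtain V1 V2 where "openin (subtopology (full_shift G A) X) V1" "x \<in> V1"
    "openin (subtopology (full_shift G A) X) V2" "y \<in> V2" "V1 \<times> V2 \<subseteq> V"
    using V(1,3) unfolding openin_prod_topology_alt by force
  then obtain T1 T2 where T: "openin (full_shift G A) T1" "x \<in> T1" "openin (full_shift G A) T2"
    "y \<in> T2" "(T1 \<inter> X) \<times> (T2 \<inter> X) \<subseteq> V"
    unfolding openin_subtopology by blast
  obtain a where a: "\<forall>s\<in>configs {0, 1}. (\<forall>k\<in>ball a. s k = t k) \<longrightarrow> s \<in> U"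
    using open_contains_cylinder U unfolding binary_shift_def by blast
  obtain b where b: "\<forall>s\<in>configs A. (\<forall>k\<in>ball b. s k = x k) \<longrightarrow> s \<in> T1"
    using open_contains_cylinder T by blast
  obtain c where c: "\<forall>s\<in>configs A. (\<forall>k\<in>ball c. s k = y k) \<longrightarrow> s \<in> T2"
    using open_contains_cylinder T by blast
  have "v \<in> W" if v: "v \<in> triples X" "same_view (a + b + c) u \<one> v \<one>" for v
  proof -
    obtain t' x' y' where [simp]: "v = (t', x', y')" by (cases v)
    have *: "same_view a u \<one> v \<one>" "same_view b u \<one> v \<one>" "same_view c u \<one> v \<one>"
      using v by (auto elim: same_view_mono)
    have "t' \<in> U" using a *(1) v by (simp add: same_view_def ball_closed)
    moreover have "x' \<in> T1 \<inter> X" "y' \<in> T2 \<inter> X"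
      using b c *(2,3) v subshift_subset[OF sub] by (auto simp: same_view_def ball_closed)
    ultimately show ?thesis using T V by auto
  qed
  then show ?thesis by blast
qed

text \<open>This is one direction of the Curtis-Hedlund-Lyndon theorem: continuity at the coordinate
  \<open>\<one>\<close> gives a radius for each point, compactness makes it uniform, and
  equivariance carries it to all positions.\<close>

lemma block_map_local_rule:
  assumes sub: "subshift G A X"
    and h: "block_map G (triple_space A X) act (subtopology (full_shift G A) X) (shift G) h"
  shows "h \<in> triples X \<rightarrow> X" "\<exists>r. local_rule X r h"
proof -
  note top = topspace_triple_space[OF sub]
  have cont: "continuous_map (triple_space A X) (subtopology (full_shift G A) X) h"
    and equi: "\<And>g u. g \<in> carrier G \<Longrightarrow> u \<in> triples X \<Longrightarrow> h (act g u) = shift G g (h u)"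
    using h unfolding block_map_def top by auto
  show hX: "h \<in> triples X \<rightarrow> X"
    using continuous_map_image_subset_topspace[OF cont] unfolding top by auto
  have fin: "finite A" and cl: "closedin (full_shift G A) X" using sub by (auto simp: subshift_def)
  have "compact_space (subtopology (full_shift G A) X)"
    using closedin_compact_space[OF compact_full_shift[OF fin] cl] by (rule compact_space_subtopology)
  then have compact: "compact_space (triple_space A X)"
    by (simp add: compact_space_prod_topology binary_shift_def compact_full_shift)
  have "continuous_map (subtopology (full_shift G A) X) (discrete_topology A) (\<lambda>x. x \<one>)"
    unfolding full_shift_def
    by (intro continuous_map_from_subtopology continuous_map_product_projection) auto
  from continuous_map_compose[OF cont this]
  have coord: "continuous_map (triple_space A X) (discrete_topology A) (\<lambda>u. h u \<one>)"
    by (simp add: o_def)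
  have "\<exists>n. \<forall>v\<in>triples X. same_view n u \<one> v \<one> \<longrightarrow> h v \<one> = h u \<one>" if u: "u \<in> triples X" for u
  proof -
    have "h u \<one> \<in> A" using hX u subshift_subset[OF sub] by auto
    then have "openin (triple_space A X) {v \<in> topspace (triple_space A X). h v \<one> \<in> {h u \<one>}}"
      by (intro openin_continuous_map_preimage[OF coord]) auto
    from open_contains_triple_cylinder[OF sub this, of u] u show ?thesis unfolding top by auto
  qed
  then obtain n where n: "\<And>u v. u \<in> triples X \<Longrightarrow> v \<in> triples X \<Longrightarrow>
      same_view (n u) u \<one> v \<one> \<Longrightarrow> h v \<one> = h u \<one>" by metis
  \<comment> \<open>The radius \<open>n u\<close> still depends on \<open>u\<close>; a finite
    subcover by these cylinders bounds it.\<close>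
  define cyl where "cyl u = {v \<in> triples X. same_view (n u) u \<one> v \<one>}" for u
  have "u \<in> cyl u" if "u \<in> triples X" for u
    using that by (simp add: cyl_def same_view_def)
  then have "topspace (triple_space A X) \<subseteq> \<Union> (cyl ` triples X)" unfolding top by blast
  moreover have "\<forall>U\<in>cyl ` triples X. openin (triple_space A X) U"
    unfolding cyl_def using openin_triple_cylinder[OF sub] by blast
  ultimately obtain \<F> where "finite \<F>" "\<F> \<subseteq> cyl ` triples X" and cover: "triples X \<subseteq> \<Union>\<F>"
    using compact unfolding compact_space_alt top by meson
  then obtain T where T: "T \<subseteq> triples X" "finite T" "\<F> = cyl ` T"
    using finite_subset_image by metis
  obtain r where r: "\<And>u. u \<in> T \<Longrightarrow> n u \<le> r"
    using T(2) finite_nat_set_iff_bounded_le[of "n ` T"] by auto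
  have at_one: "h v \<one> = h w \<one>"
    if vw: "v \<in> triples X" "w \<in> triples X" "same_view r v \<one> w \<one>" for v w
  proof -
    obtain u where u: "u \<in> T" "v \<in> cyl u" using cover vw(1) T(3) by blast
    have "same_view (n u) u \<one> w \<one>"
      using u(2) same_view_mono[OF vw(3) r[OF u(1)]] by (auto simp: cyl_def same_view_def)
    then show ?thesis using n[of u v] n[of u w] u vw T(1) by (auto simp: cyl_def)
  qed
  have "local_rule X r h"
    unfolding local_rule_def
  proof (intro ballI impI)
    fix u u' g g'
    assume *: "u \<in> triples X" "u' \<in> triples X" "g \<in> carrier G" "g' \<in> carrier G"
      "same_view r u g u' g'"
    \<comment> \<open>Equivariance brings every position to the identity, where
      \<open>at_one\<close> applies.\<close>
    have move: "h v k = h (act (inv k) v) \<one>" if "v \<in> triples X" "k \<in> carrier G" for v k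
      using that by (simp add: equi)
    have "same_view r (act (inv g) u) \<one> (act (inv g') u') \<one>"
      using * by (simp add: same_view_def ball_closed)
    then have "h (act (inv g) u) \<one> = h (act (inv g') u') \<one>"
      using * act_triples[OF sub] by (intro at_one) auto
    then show "h u g = h u' g'" using move * by simp
  qed
  then show "\<exists>r. local_rule X r h" by blast
qed

text \<open>The converse direction: preimages under a coordinate are unions of cylinders, and
  equivariance is the local rule applied to the equal views at \<open>k\<close> and
  \<open>inv g \<otimes> k\<close>.\<close>

lemma local_rule_block_map:
  assumes sub: "subshift G A X" and hX: "h \<in> triples X \<rightarrow> X" and loc: "local_rule X r h"
  shows "block_map G (triple_space A X) act (subtopology (full_shift G A) X) (shift G) h"
proof -
  note top = topspace_triple_space[OF sub]
  have X: "X \<subseteq> configs A" by (rule subshift_subset[OF sub])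
  have "continuous_map (triple_space A X) (product_topology (\<lambda>_. discrete_topology A) (carrier G)) h"
    unfolding continuous_map_componentwise
  proof (intro conjI ballI)
    show "h ` topspace (triple_space A X) \<subseteq> extensional (carrier G)"
    proof (rule image_subsetI)
      fix u assume "u \<in> topspace (triple_space A X)"
      then have "h u \<in> X" using hX unfolding top by (rule funcset_mem[rotated])
      then show "h u \<in> extensional (carrier G)" using X by (auto simp: PiE_iff)
    qed
  next
    fix k assume k: "k \<in> carrier G"
    have "openin (triple_space A X) {u \<in> triples X. h u k \<in> W}" for W
    proof (subst openin_subopen, intro ballI)
      fix u assume u: "u \<in> {u \<in> triples X. h u k \<in> W}"
      have "u \<in> {v \<in> triples X. same_view r u k v k}"
        using u by (simp add: same_view_def)
      moreover have "{v \<in> triples X. same_view r u k v k} \<subseteq> {u \<in> triples X. h u k \<in> W}"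
      proof
        fix v assume v: "v \<in> {v \<in> triples X. same_view r u k v k}"
        then have "h u k = h v k" using u by (intro local_ruleD[OF loc _ _ _ k k]) simp_all
        then show "v \<in> {u \<in> triples X. h u k \<in> W}" using u v by simp
      qed
      moreover have "openin (triple_space A X) {v \<in> triples X. same_view r u k v k}"
        using openin_triple_cylinder[OF sub _ k] u by blast
      ultimately show "\<exists>T. openin (triple_space A X) T \<and> u \<in> T \<and> T \<subseteq> {u \<in> triples X. h u k \<in> W}"
        by blast
    qed
    moreover have "h u k \<in> A" if "u \<in> triples X" for u
      using funcset_mem[OF hX that] X k by auto
    ultimately show "continuous_map (triple_space A X) (discrete_topology A) (\<lambda>u. h u k)"
      unfolding continuous_map_def top by auto
  qed
  then have "continuous_map (triple_space A X) (subtopology (full_shift G A) X) h"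
    using hX unfolding continuous_map_in_subtopology top full_shift_def[symmetric] by auto
  moreover have "h (act g u) = shift G g (h u)" if g: "g \<in> carrier G" and u: "u \<in> triples X" for g u
  proof
    fix k
    have "h u \<in> configs A" "h (act g u) \<in> configs A"
      using funcset_mem[OF hX u] funcset_mem[OF hX act_triples[OF sub g u]] X by auto
    moreover have "h (act g u) k = h u (inv g \<otimes> k)" if "k \<in> carrier G"
      using that g u act_triples[OF sub g u]
      by (intro local_ruleD[OF loc same_view_act]) auto
    ultimately show "h (act g u) k = shift G g (h u) k"
      by (cases "k \<in> carrier G") (auto simp: shift_def)
  qed
  ultimately show ?thesis unfolding block_map_def top by auto
qed

lemma const_config_binary:
  "const_config G 0 \<in> configs {0, 1::nat}" "const_config G 1 \<in> configs {0, 1::nat}"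
  by (auto simp: const_config_def)

text \<open>Continuity and equivariance of contractions enter the later arguments only in this
  combinatorial form.\<close>

lemma contraction_iff:
  assumes sub: "subshift G A X"
  shows "contraction G A X h \<longleftrightarrow> h \<in> triples X \<rightarrow> X \<and> (\<exists>r. local_rule X r h) \<and>
    (\<forall>x\<in>X. \<forall>y\<in>X. h (const_config G 0, x, y) = x \<and> h (const_config G 1, x, y) = y)"
proof -
  have "block_map G (triple_space A X) act (subtopology (full_shift G A) X) (shift G) h \<longleftrightarrow>
      h \<in> triples X \<rightarrow> X \<and> (\<exists>r. local_rule X r h)"
    (is "?block \<longleftrightarrow> ?rule")
  proof
    assume ?block
    then show ?rule by (intro conjI block_map_local_rule[OF sub])
  next
    assume ?rule
    then obtain r where "h \<in> triples X \<rightarrow> X" "local_rule X r h" by (elim conjE exE)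
    then show ?block by (rule local_rule_block_map[OF sub])
  qed
  then show ?thesis unfolding contraction_def Let_def by (simp only: conj_assoc)
qed

subsection \<open>Subshifts of finite type\<close>

definition locally_in :: "('g \<Rightarrow> 'a) set \<Rightarrow> nat \<Rightarrow> ('g \<Rightarrow> 'a) \<Rightarrow> bool" where
  "locally_in X m x \<longleftrightarrow> (\<forall>g\<in>carrier G. \<exists>w\<in>X. \<forall>k\<in>nbhd g m. x k = w k)"

text \<open>Given forbidden patterns, take a ball containing all their supports. Given a window
  radius \<open>m\<close>, forbid every pattern on \<open>ball m\<close> that appears in no point of
  \<open>X\<close>; these are finitely many since \<open>A\<close> is finite.\<close>

lemma finite_type_iff_locally_in:
  assumes sub: "subshift G A X"
  shows "finite_type G A X \<longleftrightarrow> (\<exists>m. \<forall>x\<in>configs A. locally_in X m x \<longrightarrow> x \<in> X)"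
proof
  assume "finite_type G A X"
  then obtain F where F: "finite F" "\<And>P. P \<in> F \<Longrightarrow> finite_pattern G A P"
    and X: "X = {x \<in> configs A. \<forall>P\<in>F. \<not> appears_in G P x}"
    unfolding finite_type_def by blast
  have "finite (fst P) \<and> fst P \<subseteq> carrier G" if "P \<in> F" for P
    using F(2)[OF that] by (cases P) (simp add: finite_pattern_def)
  then have "finite (\<Union> (fst ` F))" "\<Union> (fst ` F) \<subseteq> carrier G"
    using F(1) by blast+
  then obtain m where m: "\<Union> (fst ` F) \<subseteq> ball m" using finite_subset_ball by blast
  have "x \<in> X" if x: "x \<in> configs A" "locally_in X m x" for x
  proof -
    have False if P: "(D, p) \<in> F" "appears_in G (D, p) x" for D p
    proof -
      obtain g where g: "g \<in> carrier G" "\<forall>d\<in>D. x (g \<otimes> d) = p d"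
        using P(2) unfolding appears_in_def by auto
      obtain w where w: "w \<in> X" "\<forall>k\<in>nbhd g m. x k = w k"
        using x(2) g(1) unfolding locally_in_def by blast
      have "D \<subseteq> ball m" using m P(1) by force
      then have "appears_in G (D, p) w"
        using g w(2) unfolding appears_in_def by (force simp: nbhd_iff)
      then show False using w(1) P(1) unfolding X by blast
    qed
    then show "x \<in> X" using x(1) unfolding X by auto
  qed
  then show "\<exists>m. \<forall>x\<in>configs A. locally_in X m x \<longrightarrow> x \<in> X" by blast
next
  assume "\<exists>m. \<forall>x\<in>configs A. locally_in X m x \<longrightarrow> x \<in> X"
  then obtain m where m: "\<And>x. x \<in> configs A \<Longrightarrow> locally_in X m x \<Longrightarrow> x \<in> X" by blast
  define F where "F = (\<lambda>p. (ball m, p)) `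
    {p \<in> ball m \<rightarrow>\<^sub>E A. \<forall>w\<in>X. \<not> appears_in G (ball m, p) w}"
  have XA: "X \<subseteq> configs A" by (rule subshift_subset[OF sub])
  have "finite A" using sub by (simp add: subshift_def)
  then have "finite F" unfolding F_def by (simp add: finite_PiE finite_ball)
  moreover have "\<forall>P\<in>F. finite_pattern G A P"
    unfolding F_def finite_pattern_def using finite_ball ball_closed by auto
  moreover have "x \<in> X" if x: "x \<in> configs A" "\<forall>P\<in>F. \<not> appears_in G P x" for x
  proof (rule m[OF x(1)], unfold locally_in_def, intro ballI)
    fix g assume g: "g \<in> carrier G"
    define p where "p = (\<lambda>b\<in>ball m. x (g \<otimes> b))"
    have p: "p \<in> ball m \<rightarrow>\<^sub>E A" using x(1) g ball_closed by (auto simp: p_def)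
    have "appears_in G (ball m, p) x"
      unfolding appears_in_def using g by (auto simp: p_def)
    then obtain w where w: "w \<in> X" "appears_in G (ball m, p) w"
      using x(2) p unfolding F_def by blast
    then obtain k where k: "k \<in> carrier G" "\<forall>b\<in>ball m. w (k \<otimes> b) = p b"
      unfolding appears_in_def by auto
    \<comment> \<open>The pattern seen at \<open>g\<close> appears in \<open>w\<close> at some other
      place \<open>k\<close>; shift invariance of \<open>X\<close> moves it back to
      \<open>g\<close>.\<close>
    have "x j = shift G (g \<otimes> inv k) w j" if "j \<in> nbhd g m" for j
    proof -
      obtain b where b: "b \<in> ball m" "j = g \<otimes> b" using \<open>j \<in> nbhd g m\<close> by (auto simp: nbhd_iff)
      then show ?thesis
        using g k shift_translate[OF g k(1) ball_closed[OF b(1)], of w] by (simp add: p_def)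
    qed
    then show "\<exists>w\<in>X. \<forall>k\<in>nbhd g m. x k = w k"
      using subshift_shift[OF sub _ w(1), of "g \<otimes> inv k"] g k by blast
  qed
  ultimately show "finite_type G A X"
    unfolding finite_type_def using XA by (intro exI[of _ F]) (auto simp: F_def)
qed


subsection \<open>Strongly contractible subshifts are of finite type\<close>

text \<open>Rule induction with the invariant that one single point of \<open>X\<close> matches
  \<open>x\<close> on the whole set. Translated balls are covered by local admissibility; at an
  almost-union, \<open>h\<close> glues the two witnesses.\<close>

lemma patching_family_in_language:
  assumes X: "X \<subseteq> configs A" and hX: "h \<in> triples X \<rightarrow> X" and loc: "local_rule X r h"
    and h0: "\<And>x y. x \<in> X \<Longrightarrow> y \<in> X \<Longrightarrow> h (const_config G 0, x, y) = x"
    and h1: "\<And>x y. x \<in> X \<Longrightarrow> y \<in> X \<Longrightarrow> h (const_config G 1, x, y) = y"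
    and diag: "\<And>t x. t \<in> configs {0, 1} \<Longrightarrow> x \<in> X \<Longrightarrow> h (t, x, x) = x"
    and x: "locally_in X R x"
    and U: "U \<in> patching_family G S (3 * r) R"
  shows "U \<subseteq> carrier G \<and> (\<exists>w\<in>X. \<forall>k\<in>U. x k = w k)"
  using U
proof induction
  case (ball a)
  then show ?case using x nbhd_closed[of a] unfolding locally_in_def by blast
next
  case (subset U V)
  then show ?case by blast
next
  case (almost_union U V)
  then have UV: "U \<subseteq> carrier G" "V \<subseteq> carrier G" by auto
  obtain u v where u: "u \<in> X" "\<And>k. k \<in> U \<Longrightarrow> x k = u k" and v: "v \<in> X" "\<And>k. k \<in> V \<Longrightarrow> x k = v k"
    using almost_union.IH by blast
  text \<open>\<open>core P Q\<close> collects the points of the almost-union where the value has to be read off from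
    the configuration known on \<open>P\<close>. The radius \<open>3 * r\<close> keeps the \<open>r\<close>-neighbourhoods of
    \<open>core U V\<close> and \<open>core V U\<close> disjoint.\<close>
  define core where "core P Q = {g \<in> carrier G. nbhd g (3 * r) \<subseteq> P \<and> \<not> nbhd g r \<subseteq> Q} \<union>
    {g \<in> P. \<forall>q\<in>Q. g \<notin> nbhd q (3 * r)}" for P Q
  have core_sub: "core P Q \<subseteq> P" if "P \<subseteq> carrier G" for P Q
    using that nbhd_refl unfolding core_def by blast
  \<comment> \<open>A common point puts \<open>g\<close> and \<open>g'\<close> within distance
    \<open>2 * r\<close>, so neither is \<open>3 * r\<close>-far from the other's set. If both were
    deep in their own sets, the \<open>r\<close>-ball around \<open>g'\<close> would lie in
    \<open>U\<close>, against \<open>g' \<in> core V U\<close>.\<close>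
  have disj: False if "g \<in> core U V" "g' \<in> core V U" "k \<in> nbhd g r" "k \<in> nbhd g' r" for g g' k
  proof -
    have c: "g \<in> U" "g' \<in> V" "g \<in> carrier G" "g' \<in> carrier G" "k \<in> carrier G"
      using that core_sub UV nbhd_closed by blast+
    have near: "g' \<in> nbhd g (2 * r)" "g \<in> nbhd g' (2 * r)"
      using nbhd_trans[OF c(3) that(3) nbhd_sym[OF c(4) that(4)], of "2 * r"]
        nbhd_trans[OF c(4) that(4) nbhd_sym[OF c(3) that(3)], of "2 * r"] by simp_all
    have "nbhd g r \<subseteq> nbhd g' (3 * r)" "nbhd g' r \<subseteq> nbhd g (3 * r)"
      using nbhd_trans[OF c(3) near(1), of _ r "3 * r"] nbhd_trans[OF c(4) near(2), of _ r "3 * r"]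
      by auto
    moreover have "g' \<in> nbhd g (3 * r)" "g \<in> nbhd g' (3 * r)"
      using near nbhd_mono[of "2 * r" "3 * r"] by auto
    ultimately show False using that(1,2) c unfolding core_def by blast
  qed
  \<comment> \<open>By \<open>disj\<close>, this \<open>t\<close> vanishes around
    \<open>core U V\<close>. So \<open>h\<close> returns \<open>u\<close> on \<open>core U V\<close>
    and \<open>v\<close> on \<open>core V U\<close>.\<close>
  define t :: "'g \<Rightarrow> nat"
    where "t = (\<lambda>k\<in>carrier G. if \<exists>g\<in>core V U. k \<in> nbhd g r then 1 else 0)"
  have t: "t \<in> configs {0, 1}" by (auto simp: t_def)
  define z where "z = h (t, u, v)"
  have z: "z \<in> X" unfolding z_def using hX t u v by blast
  have zU: "z g = x g" if g: "g \<in> core U V" for g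
  proof -
    have gc: "g \<in> U" "g \<in> carrier G" using core_sub UV g by blast+
    have "t k = const_config G 0 k" if "k \<in> nbhd g r" for k
      using disj[OF g] that nbhd_closed[OF gc(2) that] by (auto simp: t_def const_config_def)
    then have "z g = h (const_config G 0, u, v) g"
      unfolding z_def using t u v gc const_config_binary
      by (intro local_rule_cong_nbhd[OF loc]) auto
    then show ?thesis using h0 u v gc by simp
  qed
  have zV: "z g = x g" if g: "g \<in> core V U" for g
  proof -
    have gc: "g \<in> V" "g \<in> carrier G" using core_sub UV g by blast+
    have "t k = const_config G 1 k" if "k \<in> nbhd g r" for k
      using g that nbhd_closed[OF gc(2) that] by (auto simp: t_def const_config_def)
    then have "z g = h (const_config G 1, u, v) g"
      unfolding z_def using t u v gc const_config_binary
      by (intro local_rule_cong_nbhd[OF loc]) auto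
    then show ?thesis using h1 u v gc by simp
  qed
  \<comment> \<open>On such a ball both witnesses equal \<open>x\<close>, so \<open>v\<close> may be
    replaced by \<open>u\<close>, and \<open>diag\<close> gives the value for any
    \<open>t\<close>.\<close>
  have both: "z g = x g" if g: "g \<in> carrier G" "nbhd g r \<subseteq> U" "nbhd g r \<subseteq> V" for g
  proof -
    have "z g = h (t, u, u) g"
      unfolding z_def
    proof (intro local_rule_cong_nbhd[OF loc])
      show "v k = u k" if "k \<in> nbhd g r" for k using that g u(2) v(2) by (metis subsetD)
    qed (use t u v g in auto)
    then show ?thesis using diag[OF t u(1)] u(2) g nbhd_refl[OF g(1), of r] by auto
  qed
  have r3: "nbhd g r \<subseteq> nbhd g (3 * r)" for g by (rule nbhd_mono) simp
  have mult: "P <#> ball (3 * r) = (\<Union>p\<in>P. nbhd p (3 * r))" for P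
    by (auto simp: set_mult_def l_coset_def)
  have "g \<in> carrier G \<and> x g = z g" if g: "g \<in> almost_union G S (3 * r) U V" for g
  proof -
    \<comment> \<open>A point of \<open>U\<close> lies in its own \<open>3 * r\<close>-thickening,
      so avoiding the intersection means avoiding the thickening of \<open>V\<close>; symmetrically
      for a point of \<open>V\<close>.\<close>
    consider "g \<in> carrier G" "nbhd g (3 * r) \<subseteq> U" | "g \<in> carrier G" "nbhd g (3 * r) \<subseteq> V" |
      "g \<in> U" "\<forall>q\<in>V. g \<notin> nbhd q (3 * r)" | "g \<in> V" "\<forall>q\<in>U. g \<notin> nbhd q (3 * r)"
      using g nbhd_refl UV unfolding almost_union_def erosion_def mult by blast
    \<comment> \<open>A point deep in one set is in the corresponding core unless its
      \<open>r\<close>-ball lies in the other set as well.\<close>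
    then have "g \<in> carrier G \<and> (g \<in> core U V \<or> g \<in> core V U \<or> (nbhd g r \<subseteq> U \<and> nbhd g r \<subseteq> V))"
      using r3[of g] UV unfolding core_def by cases blast+
    then show ?thesis using zU zV both by fastforce
  qed
  then show ?case using z by blast
qed

text \<open>The window radius is the \<open>R\<close> that patching supplies for
  \<open>3 * r\<close>. A locally admissible \<open>x\<close> outside the closed set
  \<open>X\<close> would be separated from it by a cylinder on some ball, while patching yields a
  point of \<open>X\<close> agreeing with \<open>x\<close> on a larger ball.\<close>

theorem strongly_contractible_imp_finite_type:
  assumes sub: "subshift G A X" and strong: "strongly_contractible_subshift G A X"
    and patch: "patching_property G S"
  shows "finite_type G A X"
proof -
  obtain h where h: "contraction G A X h" "\<forall>t\<in>configs {0, 1}. \<forall>x\<in>X. h (t, x, x) = x"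
    using strong by (auto simp: strongly_contractible_subshift_def binary_shift_def)
  obtain r where hX: "h \<in> triples X \<rightarrow> X" and loc: "local_rule X r h"
    and ends: "\<forall>x\<in>X. \<forall>y\<in>X. h (const_config G 0, x, y) = x \<and> h (const_config G 1, x, y) = y"
    using h(1)[unfolded contraction_iff[OF sub]] by (elim conjE exE)
  obtain R where R: "\<And>n. n > R \<Longrightarrow> ball n \<in> patching_family G S (3 * r) R"
  proof -
    obtain R where R: "\<forall>n>R. \<forall>a\<in>carrier G. nbhd a n \<in> patching_family G S (3 * r) R"
      using patch unfolding patching_property_def by blast
    have "nbhd \<one> n \<in> patching_family G S (3 * r) R" if "n > R" for n
      using R that by simp
    then show ?thesis unfolding nbhd_one by (rule that)
  qed
  have "x \<in> X" if x: "x \<in> configs A" "locally_in X R x" for x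
  proof (rule ccontr)
    assume "x \<notin> X"
    then have "openin (full_shift G A) (configs A - X)" "x \<in> configs A - X"
      using sub x(1) by (auto simp: subshift_def closedin_def)
    from open_contains_cylinder[OF this] obtain n
      where n: "\<forall>y\<in>configs A. (\<forall>k\<in>ball n. y k = x k) \<longrightarrow> y \<in> configs A - X" ..
    \<comment> \<open>The radius \<open>n + R + 1\<close> exceeds \<open>R\<close>, as patching
      demands, and the ball contains the window \<open>ball n\<close>.\<close>
    have "\<exists>w\<in>X. \<forall>k\<in>ball (n + R + 1). x k = w k"
      by (rule patching_family_in_language[OF subshift_subset[OF sub] hX loc _ _ _ x(2) R,
            THEN conjunct2])
        (simp_all add: ends h(2) del: One_nat_def)
    then obtain w where w: "w \<in> X" "\<forall>k\<in>ball (n + R + 1). x k = w k" by blast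
    have "w k = x k" if "k \<in> ball n" for k
      using w(2) subsetD[OF ball_mono that, of "n + R + 1"] by simp
    then show False using n w(1) subshift_subset[OF sub] by blast
  qed
  then show ?thesis unfolding finite_type_iff_locally_in[OF sub] by blast
qed


end

subsection \<open>Contractible subshifts of finite type are strongly contractible\<close>

locale contractible_sft = marked_group G S for G :: "('g, 'm) monoid_scheme" (structure) and S +
  fixes A :: "'a set" and X :: "('g \<Rightarrow> 'a) set" and r m h
  assumes sub: "subshift G A X"
    and hX: "h \<in> triples X \<rightarrow> X" and loc: "local_rule X r h"
    and h0: "x \<in> X \<Longrightarrow> y \<in> X \<Longrightarrow> h (const_config G 0, x, y) = x"
    and h1: "x \<in> X \<Longrightarrow> y \<in> X \<Longrightarrow> h (const_config G 1, x, y) = y"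
    and sft: "x \<in> configs A \<Longrightarrow> locally_in X m x \<Longrightarrow> x \<in> X"
begin

text \<open>Evaluating \<open>h\<close> on a window of radius \<open>m\<close> reads exactly up to
  this distance from the centre.\<close>

definition rad :: nat where "rad = r + m"

text \<open>With radius \<open>2 * rad\<close>, one such point in a ball of radius
  \<open>rad\<close> forces the two configurations to coincide on that whole ball.\<close>

definition agree :: "('g \<Rightarrow> nat) \<times> ('g \<Rightarrow> 'a) \<times> ('g \<Rightarrow> 'a) \<Rightarrow> 'g \<Rightarrow> bool" where
  "agree u g \<longleftrightarrow> (\<forall>k\<in>nbhd g (2 * rad). fst (snd u) k = snd (snd u) k)"

definition draft :: "('g \<Rightarrow> nat) \<times> ('g \<Rightarrow> 'a) \<times> ('g \<Rightarrow> 'a) \<Rightarrow> 'g \<Rightarrow> 'a" where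
  "draft u g = (if agree u g then fst (snd u) g else h u g)"

text \<open>The values of \<open>h\<close> on the ball of radius \<open>rad\<close> depend on
  \<open>t\<close> up to distance \<open>rad + r\<close>, hence the larger radius in the condition
  on \<open>t\<close>.\<close>

definition crossing :: "('g \<Rightarrow> nat) \<times> ('g \<Rightarrow> 'a) \<times> ('g \<Rightarrow> 'a) \<Rightarrow> 'g \<Rightarrow> bool" where
  "crossing u g \<longleftrightarrow> ((\<exists>k\<in>nbhd g rad. agree u k) \<and> (\<exists>k\<in>nbhd g rad. \<not> agree u k)) \<and>
     \<not> ((\<forall>k\<in>nbhd g (rad + r). fst u k = 0) \<or> (\<forall>k\<in>nbhd g (rad + r). fst u k = 1))"

definition mask :: "('g \<Rightarrow> nat) \<times> ('g \<Rightarrow> 'a) \<times> ('g \<Rightarrow> 'a) \<Rightarrow> 'g \<Rightarrow> nat" where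
  "mask u = (\<lambda>g\<in>carrier G. if \<exists>k\<in>nbhd g rad. crossing u k then 1 else 0)"

definition extends_draft ::
    "('g \<Rightarrow> nat) \<times> ('g \<Rightarrow> 'a) \<times> ('g \<Rightarrow> 'a) \<Rightarrow> 'g \<Rightarrow> ('g \<Rightarrow> 'a) \<Rightarrow> bool" where
  "extends_draft u g w \<longleftrightarrow> w \<in> X \<and> (\<forall>k\<in>nbhd g r. w k = draft u k)"

text \<open>The draft need not lie in \<open>X\<close>, so \<open>h\<close> is fed a point of
  \<open>X\<close> that matches it on the \<open>r\<close>-ball that \<open>h\<close> reads. Such a
  point can be missing only at a crossing, where the mask is \<open>1\<close> all around and
  \<open>h\<close> would return the first configuration anyway; this explains the default.\<close>

definition repaired :: "('g \<Rightarrow> nat) \<times> ('g \<Rightarrow> 'a) \<times> ('g \<Rightarrow> 'a) \<Rightarrow> 'g \<Rightarrow> 'a" where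
  "repaired u = (\<lambda>g\<in>carrier G. if Ex (extends_draft u g)
     then h (mask u, SOME w. extends_draft u g w, fst (snd u)) g else fst (snd u) g)"

lemma X_configs: "x \<in> X \<Longrightarrow> x \<in> configs A"
  using subshift_subset[OF sub] by blast

lemma mask_binary: "mask u \<in> configs {0, 1}"
  by (auto simp: mask_def)

lemma h_in_X: "t \<in> configs {0, 1} \<Longrightarrow> x \<in> X \<Longrightarrow> y \<in> X \<Longrightarrow> h (t, x, y) \<in> X"
  using hX by blast

lemma h_cong:
  assumes "t \<in> configs {0, 1}" "t' \<in> configs {0, 1}" "x \<in> X" "x' \<in> X" "y \<in> X" "y' \<in> X"
    "g \<in> carrier G" "\<And>k. k \<in> nbhd g r \<Longrightarrow> t k = t' k" "\<And>k. k \<in> nbhd g r \<Longrightarrow> x k = x' k"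
    "\<And>k. k \<in> nbhd g r \<Longrightarrow> y k = y' k"
  shows "h (t, x, y) g = h (t', x', y') g"
  using assms by (intro local_rule_cong_nbhd[OF loc]) auto

lemma h_at_0:
  assumes "t \<in> configs {0, 1}" "x \<in> X" "y \<in> X" "g \<in> carrier G" "\<And>k. k \<in> nbhd g r \<Longrightarrow> t k = 0"
  shows "h (t, x, y) g = x g"
proof -
  have "h (t, x, y) g = h (const_config G 0, x, y) g"
    using assms nbhd_closed const_config_binary by (intro h_cong) (auto simp: const_config_def)
  then show ?thesis using h0 assms by simp
qed

lemma h_at_1:
  assumes "t \<in> configs {0, 1}" "x \<in> X" "y \<in> X" "g \<in> carrier G" "\<And>k. k \<in> nbhd g r \<Longrightarrow> t k = 1"
  shows "h (t, x, y) g = y g"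
proof -
  have "h (t, x, y) g = h (const_config G 1, x, y) g"
    using assms nbhd_closed const_config_binary by (intro h_cong) (auto simp: const_config_def)
  then show ?thesis using h1 assms by simp
qed

text \<open>Two extensions coincide on the \<open>r\<close>-ball, so the choice made by
  \<open>SOME\<close> does not influence the value.\<close>

lemma repaired_eq:
  assumes "u \<in> triples X" "g \<in> carrier G" "extends_draft u g w"
  shows "repaired u g = h (mask u, w, fst (snd u)) g"
proof -
  let ?w = "SOME w. extends_draft u g w"
  have w: "extends_draft u g ?w" by (rule someI[of _ w]) (rule assms)
  have "h (mask u, ?w, fst (snd u)) g = h (mask u, w, fst (snd u)) g"
    using assms w mask_binary[of u] by (intro h_cong) (auto simp: extends_draft_def)
  then show ?thesis using assms by (auto simp: repaired_def)
qed

text \<open>If all points of the ball agree, \<open>x\<close> is a witness; if none does,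
  \<open>h u\<close> is. In the mixed case \<open>t\<close> is constant around \<open>g\<close>, so
  \<open>h\<close> returns \<open>x\<close> or \<open>y\<close>, and these coincide on the
  ball.\<close>

lemma draft_in_language:
  assumes u: "u \<in> triples X" and g: "g \<in> carrier G" and nc: "\<not> crossing u g"
  shows "\<exists>w\<in>X. \<forall>k\<in>nbhd g rad. w k = draft u k"
proof -
  obtain t x y where [simp]: "u = (t, x, y)" by (cases u)
  have txy: "t \<in> configs {0, 1}" "x \<in> X" "y \<in> X" using u by auto
  have hu: "h u \<in> X" using hX u by blast
  consider "\<forall>k\<in>nbhd g rad. agree u k" | "\<forall>k\<in>nbhd g rad. \<not> agree u k" |
    k0 where "k0 \<in> nbhd g rad" "agree u k0"
      "(\<forall>k\<in>nbhd g (rad + r). t k = 0) \<or> (\<forall>k\<in>nbhd g (rad + r). t k = 1)"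
    using nc unfolding crossing_def by auto
  then show ?thesis
  proof cases
    case 1
    then show ?thesis using txy by (intro bexI[of _ x]) (auto simp: draft_def)
  next
    case 2
    then show ?thesis using hu by (intro bexI[of _ "h u"]) (auto simp: draft_def)
  next
    case (3 k0)
    have "x k = draft u k" if k: "k \<in> nbhd g rad" for k
    proof -
      have kc: "k \<in> carrier G" using nbhd_closed[OF g k] .
      have k0c: "k0 \<in> carrier G" using nbhd_closed[OF g 3(1)] .
      have "k \<in> nbhd k0 (2 * rad)"
        by (rule nbhd_trans[OF k0c nbhd_sym[OF g 3(1)] k]) simp
      then have xy: "x k = y k" using 3(2) by (simp add: agree_def)
      have "j \<in> nbhd g (rad + r)" if "j \<in> nbhd k r" for j
        by (rule nbhd_trans[OF g k that]) simp
      then have "h (t, x, y) k = x k"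
        using 3(3) h_at_0[OF txy kc] h_at_1[OF txy kc] xy by auto
      then show ?thesis by (simp add: draft_def)
    qed
    then show ?thesis using txy by blast
  qed
qed

text \<open>Each window of radius \<open>m\<close> is checked. Either the mask is \<open>1\<close>
  wherever \<open>h\<close> looks and the window shows \<open>x\<close>, or the centre is no
  crossing and one extension \<open>w\<close> serves the whole window.\<close>

lemma repaired_in_X:
  assumes u: "u \<in> triples X"
  shows "repaired u \<in> X"
proof (rule sft)
  obtain t x y where [simp]: "u = (t, x, y)" by (cases u)
  have txy: "t \<in> configs {0, 1}" "x \<in> X" "y \<in> X" using u by auto
  have "repaired u g \<in> A" if g: "g \<in> carrier G" for g
  proof (cases "\<exists>w. extends_draft u g w")
    case True
    then obtain w where w: "extends_draft u g w" by blast
    then have "h (mask u, w, x) \<in> X"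
      using h_in_X[OF mask_binary _ txy(2)] by (simp add: extends_draft_def)
    then show ?thesis using repaired_eq[OF u g w] X_configs g by fastforce
  next
    case False
    then show ?thesis using X_configs[OF txy(2)] g by (auto simp: repaired_def)
  qed
  then show "repaired u \<in> configs A" by (auto simp: repaired_def)
  show "locally_in X m (repaired u)"
    unfolding locally_in_def
  proof
    fix g assume g: "g \<in> carrier G"
    have sub_n: "j \<in> nbhd g rad" if "k \<in> nbhd g m" "j \<in> nbhd k r" for j k
      by (rule nbhd_trans[OF g that]) (simp add: rad_def)
    show "\<exists>w\<in>X. \<forall>k\<in>nbhd g m. repaired u k = w k"
    proof (cases "\<forall>k\<in>nbhd g rad. mask u k = 1")
      case True
      have "repaired u k = x k" if k: "k \<in> nbhd g m" for k
      proof (cases "\<exists>w. extends_draft u k w")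
        case ex: True
        then obtain w where w: "extends_draft u k w" by blast
        have kc: "k \<in> carrier G" using nbhd_closed[OF g k] .
        have "h (mask u, w, x) k = x k"
          using w True sub_n[OF k] txy kc mask_binary by (intro h_at_1) (auto simp: extends_draft_def)
        then show ?thesis using repaired_eq[OF u kc w] by simp
      next
        case False
        then show ?thesis using nbhd_closed[OF g k] by (auto simp: repaired_def)
      qed
      then show ?thesis using txy by blast
    next
      case False
      then obtain k where k: "k \<in> nbhd g rad" "mask u k \<noteq> 1" by blast
      \<comment> \<open>A crossing at \<open>g\<close> would set the mask to \<open>1\<close> on the
        whole \<open>rad\<close>-ball, including \<open>k\<close>.\<close>
      then have "\<not> crossing u g"
        using nbhd_sym[OF g k(1)] nbhd_closed[OF g k(1)] by (auto simp: mask_def split: if_splits)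
      then obtain w where w: "w \<in> X" "\<forall>k\<in>nbhd g rad. w k = draft u k"
        using draft_in_language[OF u g] by blast
      have "repaired u k = h (mask u, w, x) k" if k: "k \<in> nbhd g m" for k
      proof -
        have "extends_draft u k w" using w sub_n[OF k] by (auto simp: extends_draft_def)
        then show ?thesis using repaired_eq[OF u nbhd_closed[OF g k]] by simp
      qed
      moreover have "h (mask u, w, x) \<in> X" by (rule h_in_X[OF mask_binary w(1) txy(2)])
      ultimately show ?thesis by blast
    qed
  qed
qed

lemma repaired_eq_draft:
  assumes u: "u \<in> triples X" and nc: "\<And>g. g \<in> carrier G \<Longrightarrow> \<not> crossing u g"
    and w: "w \<in> X" "\<And>g. g \<in> carrier G \<Longrightarrow> draft u g = w g"
  shows "repaired u = w"
proof (rule PiE_ext[of _ "carrier G" "\<lambda>_. A"])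
  fix g assume g: "g \<in> carrier G"
  have "extends_draft u g w" using w nbhd_closed[OF g] by (simp add: extends_draft_def)
  then have "repaired u g = h (mask u, w, fst (snd u)) g" by (rule repaired_eq[OF u g])
  also have "\<dots> = w g"
  proof (rule h_at_0[OF mask_binary w(1) _ g])
    show "mask u k = 0" if "k \<in> nbhd g r" for k
      using nbhd_closed[OF g that] nbhd_closed[OF nbhd_closed[OF g that]] nc by (auto simp: mask_def)
  qed (use u in auto)
  finally show "repaired u g = w g" .
qed (use X_configs repaired_in_X[OF u] w in auto)

lemma repaired_const:
  assumes x: "x \<in> X" and y: "y \<in> X"
  shows "repaired (const_config G 0, x, y) = x" "repaired (const_config G 1, x, y) = y"
proof -
  have "\<not> crossing (const_config G c, x, y) g" if "g \<in> carrier G" "c \<in> {0, 1}" for g c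
    using nbhd_closed[OF that(1)] that(2) by (auto simp: crossing_def const_config_def)
  \<comment> \<open>For \<open>t\<close> constantly \<open>1\<close> the draft is \<open>y\<close>
    even where it copies \<open>x\<close>.\<close>
  moreover have "x g = y g" if "g \<in> carrier G" "agree (t, x, y) g" for g t
    using that nbhd_refl[OF that(1)] by (simp add: agree_def)
  ultimately show "repaired (const_config G 0, x, y) = x" "repaired (const_config G 1, x, y) = y"
    using x y const_config_binary
    by (intro repaired_eq_draft; simp add: draft_def h0 h1[unfolded One_nat_def])+
qed

text \<open>All points agree, so the draft copies \<open>x\<close> without consulting
  \<open>h\<close>, and no crossing can occur.\<close>

lemma repaired_diag:
  assumes "t \<in> configs {0, 1}" "x \<in> X"
  shows "repaired (t, x, x) = x"
  using assms by (intro repaired_eq_draft) (auto simp: draft_def crossing_def agree_def)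

text \<open>The radii of the ingredients are added up. Only the choice of an extension is not
  visibly local; it is handled by transporting extensions with the shift and by independence of the
  choice.\<close>

lemma repaired_local: "\<exists>q. local_rule X q repaired"
proof -
  have agree: "local_rule X (2 * rad + 0) agree"
    unfolding agree_def[abs_def]
    by (intro local_rule_Ball local_rule_map2[where f = "(=)"] local_rule_proj)
  define a where "a = 2 * rad + r"
  have agree_a: "local_rule X a agree" by (rule local_rule_mono[OF agree]) (simp add: a_def)
  have "local_rule X a h" by (rule local_rule_mono[OF loc]) (simp add: a_def)
  then have draft: "local_rule X a draft"
    using local_rule_map2[OF local_rule_map2[OF agree_a local_rule_proj(2), of Pair] \<open>local_rule X a h\<close>,
        of "\<lambda>(c, a) b. if c then a else b"]
    unfolding draft_def[abs_def] by simp
  have near: "local_rule X (rad + a) (\<lambda>u g. \<exists>k\<in>nbhd g rad. agree u k)"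
    by (rule local_rule_Bex[OF agree_a])
  have far: "local_rule X (rad + a) (\<lambda>u g. \<exists>k\<in>nbhd g rad. \<not> agree u k)"
    by (rule local_rule_Bex[OF local_rule_map[OF agree_a]])
  have const: "local_rule X (rad + a) (\<lambda>u g. \<forall>k\<in>nbhd g (rad + r). fst u k = c)" for c
  proof (rule local_rule_mono)
    show "local_rule X (rad + r + 0) (\<lambda>u g. \<forall>k\<in>nbhd g (rad + r). fst u k = c)"
      by (rule local_rule_Ball[OF local_rule_map[OF local_rule_proj(1), where f = "\<lambda>v. v = c"]])
  qed (simp add: a_def)
  have "local_rule X (rad + a) crossing"
    unfolding crossing_def[abs_def]
    by (intro local_rule_map2[where f = "(\<and>)"] local_rule_map[where f = Not]
        local_rule_map2[where f = "(\<or>)"] near far const)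
  then have "local_rule X (rad + (rad + a)) (\<lambda>u g. \<exists>k\<in>nbhd g rad. crossing u k)"
    by (rule local_rule_Bex)
  then have mask: "local_rule X (2 * rad + a) mask"
    unfolding local_rule_def mask_def by (simp add: mult_2 add.assoc)
  \<comment> \<open>One \<open>rad\<close> is spent on searching for a crossing, another on its
    search for agreeing points, and \<open>a\<close> on testing agreement.\<close>
  define q where "q = 2 * rad + a"
  have draft_q: "local_rule X q draft" by (rule local_rule_mono[OF draft]) (simp add: q_def)
  have mask_q: "local_rule X q mask" using mask by (simp add: q_def)
  have "local_rule X (r + q) repaired"
    unfolding local_rule_def
  proof (intro ballI impI)
    fix u u' g g'
    assume u: "u \<in> triples X" "u' \<in> triples X" and g: "g \<in> carrier G" "g' \<in> carrier G"
      and view: "same_view (r + q) u g u' g'"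
    have eq: "draft u (g \<otimes> b) = draft u' (g' \<otimes> b)" "mask u (g \<otimes> b) = mask u' (g' \<otimes> b)"
      "fst (snd u) (g \<otimes> b) = fst (snd u') (g' \<otimes> b)" if b: "b \<in> ball r" for b
    proof -
      have v: "same_view q u (g \<otimes> b) u' (g' \<otimes> b)" using same_view_move view b g by blast
      have c: "g \<otimes> b \<in> carrier G" "g' \<otimes> b \<in> carrier G" using g b ball_closed by auto
      show "draft u (g \<otimes> b) = draft u' (g' \<otimes> b)" "mask u (g \<otimes> b) = mask u' (g' \<otimes> b)"
        using local_ruleD[OF _ v u c] draft_q mask_q by blast+
      show "fst (snd u) (g \<otimes> b) = fst (snd u') (g' \<otimes> b)"
        by (rule local_ruleD[OF local_rule_proj(2) v u c])
    qed
    \<comment> \<open>Used in both directions, this also shows that an extension exists at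
      \<open>g\<close> if and only if one exists at \<open>g'\<close>.\<close>
    have move: "extends_draft v' k' (shift G (k' \<otimes> inv k) w)"
      if w: "extends_draft v k w" and k: "k \<in> carrier G" "k' \<in> carrier G"
        and dr: "\<And>b. b \<in> ball r \<Longrightarrow> draft v (k \<otimes> b) = draft v' (k' \<otimes> b)" for v v' k k' w
      unfolding extends_draft_def nbhd_Ball
    proof (intro conjI ballI)
      show "shift G (k' \<otimes> inv k) w \<in> X"
        using subshift_shift[OF sub] w k by (simp add: extends_draft_def)
      fix b assume b: "b \<in> ball r"
      show "shift G (k' \<otimes> inv k) w (k' \<otimes> b) = draft v' (k' \<otimes> b)"
        using w dr[OF b] b shift_translate[OF k(2,1) ball_closed[OF b], of w]
        by (simp add: extends_draft_def nbhd_Ball)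
    qed
    show "repaired u g = repaired u' g'"
    proof (cases "\<exists>w. extends_draft u g w")
      case True
      then obtain w where w: "extends_draft u g w" by blast
      let ?w = "shift G (g' \<otimes> inv g) w"
      have w': "extends_draft u' g' ?w" by (rule move[OF w g eq(1)])
      have "w (g \<otimes> b) = ?w (g' \<otimes> b)" if "b \<in> ball r" for b
        using w w' eq(1)[OF that] that by (simp add: extends_draft_def nbhd_Ball)
      then have "same_view r (mask u, w, fst (snd u)) g (mask u', ?w, fst (snd u')) g'"
        using eq by (simp add: same_view_def)
      then have "h (mask u, w, fst (snd u)) g = h (mask u', ?w, fst (snd u')) g'"
        using u g w w' mask_binary by (intro local_ruleD[OF loc]) (auto simp: extends_draft_def)
      then show ?thesis using repaired_eq u g w w' by simp
    next
      case False
      then have "\<not> Ex (extends_draft u' g')" using move[OF _ g(2,1)] eq(1) by metis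
      moreover have "fst (snd u) g = fst (snd u') g'"
        by (rule local_ruleD[OF local_rule_proj(2) view u g])
      ultimately show ?thesis using False g by (auto simp: repaired_def)
    qed
  qed
  then show ?thesis by blast
qed

lemma strongly_contractible: "strongly_contractible_subshift G A X"
proof -
  have "contraction G A X repaired"
    unfolding contraction_iff[OF sub] using repaired_in_X repaired_local repaired_const by blast
  then show ?thesis
    unfolding strongly_contractible_subshift_def using repaired_diag
    by (auto simp: binary_shift_def)
qed

end

theorem (in marked_group) contractible_sft_imp_strongly_contractible:
  assumes sub: "subshift G A X" and con: "contractible_subshift G A X" and ft: "finite_type G A X"
  shows "strongly_contractible_subshift G A X"
proof -
  obtain h r where "h \<in> triples X \<rightarrow> X" "local_rule X r h"
    "\<forall>x\<in>X. \<forall>y\<in>X. h (const_config G 0, x, y) = x \<and> h (const_config G 1, x, y) = y"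
    using con unfolding contractible_subshift_def contraction_iff[OF sub] by (elim conjE exE)
  moreover obtain m where "\<forall>x\<in>configs A. locally_in X m x \<longrightarrow> x \<in> X"
    using ft finite_type_iff_locally_in[OF sub] by blast
  ultimately interpret contractible_sft G S A X r m h
    using sub by unfold_locales blast+
  show ?thesis by (rule strongly_contractible)
qed

theorem theorem1p9:
  fixes G :: "('g, 'm) monoid_scheme" and S :: "'g set"
  assumes "group G"
    and "finite S" and "symmetric_generating_set G S"
  shows "(patching_property G S \<longrightarrow>
      (\<forall>(A :: 'a set) X. subshift G A X \<and> strongly_contractible_subshift G A X \<longrightarrow>
         contractible_subshift G A X \<and> finite_type G A X)) \<and>
    ((\<exists>d\<ge>1. G \<cong> int_lattice d) \<longrightarrow>
      (\<forall>(A :: 'a set) X. subshift G A X \<and> contractible_subshift G A X \<and> finite_type G A X \<longrightarrow>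
         strongly_contractible_subshift G A X)) \<and>
    (patching_property G S \<longrightarrow>
      (\<forall>(A :: 'a set) X. subshift G A X \<and> contractible_subshift G A X \<and> finite_type G A X \<and>
         (\<exists>x\<in>X. fixed_point G x) \<longrightarrow>
         strongly_contractible_subshift G A X))"
proof -
  interpret group G by (rule assms)
  interpret marked_group G S by unfold_locales (use assms in auto)
  have "contractible_subshift G A X" if "strongly_contractible_subshift G A X" for A :: "'a set" and X
    using that by (auto simp: strongly_contractible_subshift_def contractible_subshift_def)
  then show ?thesis
    using strongly_contractible_imp_finite_type contractible_sft_imp_strongly_contractible by blast
qed

end
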